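(* Let $G$ be an abelian group and let $T$ be its torsion subgroup. Then $\mathcal{V}_\omega(\mathbb{Z}G)=\{1\}$ if and only if $\mathcal{V}_\omega(\mathbb{Z}T)=\{1\}$.
   Context: For a group $G$, $\mathbb{Z}G$ is the integral group ring, $\Delta(G)$ is its augmentation ideal, and $\Delta^n(G)$ is the $n$-th power of this ideal. $\mathcal{V}(\mathbb{Z}G)$ is the group of units of augmentation one in $\mathbb{Z}G$; for $n\ge 1$, $\mathcal{V}_n(\mathbb{Z}G)=\mathcal{V}(\mathbb{Z}G)\cap(1+\Delta^n(G))$; and $\mathcal{V}_\omega(\mathbb{Z}G)=\bigcap_{n=1}^\infty\mathcal{V}_n(\mathbb{Z}G)$. *)

theory Defs
  imports "HOL-Algebra.Algebra" "HOL-Library.Poly_Mapping"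
begin

text \<open>
  Elements of \<open>\<int>G\<close> are the finitely supported functions into the integers whose support lies
  in \<open>carrier G\<close>; \<open>frag_of g\<close> is the basis element \<open>g\<close>, and multiplication is the
  biadditive extension of the multiplication of \<open>G\<close>.
\<close>

definition int_group_ring :: "('a, 'b) monoid_scheme \<Rightarrow> ('a \<Rightarrow>\<^sub>0 int) ring"
  where "int_group_ring G =
    \<lparr>carrier = {a. Poly_Mapping.keys a \<subseteq> carrier G},
     monoid.mult = (\<lambda>a b. frag_extend (\<lambda>x. frag_extend (\<lambda>y. frag_of (x \<otimes>\<^bsub>G\<^esub> y)) b) a),
     one = frag_of \<one>\<^bsub>G\<^esub>,
     ring.zero = 0,
     add = (+)\<rparr>"

definition augmentation :: "('a \<Rightarrow>\<^sub>0 int) \<Rightarrow> int"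
  where "augmentation a = (\<Sum>x\<in>Poly_Mapping.keys a. Poly_Mapping.lookup a x)"

definition augmentation_ideal :: "('a, 'b) monoid_scheme \<Rightarrow> ('a \<Rightarrow>\<^sub>0 int) set"
  where "augmentation_ideal G = a_kernel (int_group_ring G) int_ring augmentation"

definition augmentation_power :: "('a, 'b) monoid_scheme \<Rightarrow> nat \<Rightarrow> ('a \<Rightarrow>\<^sub>0 int) set"
  where "augmentation_power G n =
    augmentation_ideal G [^]\<^bsub>ideals_set (int_group_ring G)\<^esub> n"

definition normalized_units :: "('a, 'b) monoid_scheme \<Rightarrow> ('a \<Rightarrow>\<^sub>0 int) set"
  where "normalized_units G = {u \<in> Units (int_group_ring G). augmentation u = 1}"

definition normalized_units_filt :: "('a, 'b) monoid_scheme \<Rightarrow> nat \<Rightarrow> ('a \<Rightarrow>\<^sub>0 int) set"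
  where "normalized_units_filt G n =
    normalized_units G \<inter>
      (\<one>\<^bsub>int_group_ring G\<^esub> <+\<^bsub>int_group_ring G\<^esub> augmentation_power G n)"

definition normalized_units_omega :: "('a, 'b) monoid_scheme \<Rightarrow> ('a \<Rightarrow>\<^sub>0 int) set"
  where "normalized_units_omega G = (\<Inter>n\<in>{1..}. normalized_units_filt G n)"

definition torsion_subgroup :: "('a, 'b) monoid_scheme \<Rightarrow> 'a set"
  where "torsion_subgroup G = {x \<in> carrier G. \<exists>n>0. x [^]\<^bsub>G\<^esub> (n::nat) = \<one>\<^bsub>G\<^esub>}"


lemma int_group_ring_simps:
  "carrier (int_group_ring G) = {a. Poly_Mapping.keys a \<subseteq> carrier G}"
  "monoid.mult (int_group_ring G) a b =
     frag_extend (\<lambda>x. frag_extend (\<lambda>y. frag_of (x \<otimes>\<^bsub>G\<^esub> y)) b) a"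
  "one (int_group_ring G) = frag_of \<one>\<^bsub>G\<^esub>"
  "ring.zero (int_group_ring G) = 0"
  "add (int_group_ring G) a b = a + b"
  by (simp_all add: int_group_ring_def)

lemma frag_extend_fun_add:
  "frag_extend (\<lambda>x. f x + g x) a = frag_extend f a + frag_extend g a"
  by (simp add: frag_extend_def frag_cmul_distrib2 sum.distrib)

lemma frag_extend_fun_diff:
  fixes f g :: "'a \<Rightarrow> 'b \<Rightarrow>\<^sub>0 int"
  shows "frag_extend (\<lambda>x. f x - g x) a = frag_extend f a - frag_extend g a"
proof -
  have "frag_cmul c (p - q) = frag_cmul c p - frag_cmul c q" for c and p q :: "'b \<Rightarrow>\<^sub>0 int"
    by (rule poly_mapping_eqI) (simp add: lookup_minus right_diff_distrib)
  then show ?thesis by (simp add: frag_extend_def sum_subtractf)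
qed

lemma int_group_ring_mult_closed:
  assumes "group G" "a \<in> carrier (int_group_ring G)" "b \<in> carrier (int_group_ring G)"
  shows "a \<otimes>\<^bsub>int_group_ring G\<^esub> b \<in> carrier (int_group_ring G)"
proof -
  interpret group G by fact
  have keys: "Poly_Mapping.keys (frag_extend f c) \<subseteq> carrier G"
    if "\<And>x. x \<in> Poly_Mapping.keys c \<Longrightarrow> Poly_Mapping.keys (f x) \<subseteq> carrier G"
    for f :: "'a \<Rightarrow> 'a \<Rightarrow>\<^sub>0 int" and c
    using keys_frag_extend[of f c] that by blast
  have "a \<otimes>\<^bsub>int_group_ring G\<^esub> b =
      frag_extend (\<lambda>x. frag_extend (\<lambda>y. frag_of (x \<otimes>\<^bsub>G\<^esub> y)) b) a"
    by (simp only: int_group_ring_simps)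
  moreover have "Poly_Mapping.keys \<dots> \<subseteq> carrier G"
    by (intro keys) (use assms(2,3) in \<open>auto simp: int_group_ring_simps(1)\<close>)
  ultimately show ?thesis by (simp add: int_group_ring_simps(1))
qed

lemma frag_of_mult:
  "frag_of x \<otimes>\<^bsub>int_group_ring G\<^esub> frag_of y = frag_of (x \<otimes>\<^bsub>G\<^esub> y)"
  by (simp add: int_group_ring_simps)

lemma int_group_ring_mult_diff:
  "(a - b) \<otimes>\<^bsub>int_group_ring G\<^esub> c = a \<otimes>\<^bsub>int_group_ring G\<^esub> c - b \<otimes>\<^bsub>int_group_ring G\<^esub> c"
  "c \<otimes>\<^bsub>int_group_ring G\<^esub> (a - b) = c \<otimes>\<^bsub>int_group_ring G\<^esub> a - c \<otimes>\<^bsub>int_group_ring G\<^esub> b"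
  by (simp_all add: int_group_ring_simps frag_extend_diff frag_extend_fun_diff)

lemma int_group_ring_mult_0:
  "0 \<otimes>\<^bsub>int_group_ring G\<^esub> c = 0" "c \<otimes>\<^bsub>int_group_ring G\<^esub> 0 = 0"
  by (simp_all add: int_group_ring_simps frag_extend_eq_0)

lemma ring_int_group_ring:
  assumes "group G" shows "ring (int_group_ring G)"
proof -
  interpret group G by fact
  let ?R = "int_group_ring G"
  have assoc: "a \<otimes>\<^bsub>?R\<^esub> b \<otimes>\<^bsub>?R\<^esub> c = a \<otimes>\<^bsub>?R\<^esub> (b \<otimes>\<^bsub>?R\<^esub> c)"
    if "Poly_Mapping.keys a \<subseteq> carrier G" "Poly_Mapping.keys b \<subseteq> carrier G"
      "Poly_Mapping.keys c \<subseteq> carrier G" for a b c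
    using that(1)
  proof (induction a rule: frag_induction)
    case (one x)
    show ?case using that(2)
    proof (induction b rule: frag_induction)
      case (one y)
      show ?case using that(3)
        by (induction c rule: frag_induction)
          (simp_all add: int_group_ring_mult_0 int_group_ring_mult_diff frag_of_mult
            m_assoc \<open>x \<in> carrier G\<close> \<open>y \<in> carrier G\<close>)
    qed (simp_all add: int_group_ring_mult_0 int_group_ring_mult_diff)
  qed (simp_all add: int_group_ring_mult_0 int_group_ring_mult_diff)
  have unit: "frag_of \<one>\<^bsub>G\<^esub> \<otimes>\<^bsub>?R\<^esub> a = a" "a \<otimes>\<^bsub>?R\<^esub> frag_of \<one>\<^bsub>G\<^esub> = a"
    if "Poly_Mapping.keys a \<subseteq> carrier G" for a
    using that
    by (induction a rule: frag_induction)
      (simp_all add: int_group_ring_mult_0 int_group_ring_mult_diff frag_of_mult)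
  show ?thesis
  proof (intro ringI abelian_groupI monoidI)
    fix a assume "a \<in> carrier ?R"
    then show "\<exists>b\<in>carrier ?R. b \<oplus>\<^bsub>?R\<^esub> a = \<zero>\<^bsub>?R\<^esub>"
      by (intro bexI[of _ "- a"]) (simp_all add: int_group_ring_simps)
  next
    fix a b assume "a \<in> carrier ?R" "b \<in> carrier ?R"
    then show "a \<oplus>\<^bsub>?R\<^esub> b \<in> carrier ?R"
      using Poly_Mapping.keys_add[of a b] by (auto simp: int_group_ring_simps)
  next
    fix a b assume "a \<in> carrier ?R" "b \<in> carrier ?R"
    then show "a \<otimes>\<^bsub>?R\<^esub> b \<in> carrier ?R"
      by (rule int_group_ring_mult_closed[OF assms])
  next
    fix a b c assume "a \<in> carrier ?R" "b \<in> carrier ?R" "c \<in> carrier ?R"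
    then show "a \<otimes>\<^bsub>?R\<^esub> b \<otimes>\<^bsub>?R\<^esub> c = a \<otimes>\<^bsub>?R\<^esub> (b \<otimes>\<^bsub>?R\<^esub> c)"
      by (simp add: assoc int_group_ring_simps(1))
  next
    fix a assume "a \<in> carrier ?R"
    then show "\<one>\<^bsub>?R\<^esub> \<otimes>\<^bsub>?R\<^esub> a = a" "a \<otimes>\<^bsub>?R\<^esub> \<one>\<^bsub>?R\<^esub> = a"
      by (simp_all add: unit int_group_ring_simps(1,3))
  qed (auto simp: int_group_ring_simps frag_extend_add frag_extend_fun_add add_ac)
qed

lemma augmentation_alt:
  assumes "finite S" "Poly_Mapping.keys a \<subseteq> S"
  shows "augmentation a = (\<Sum>x\<in>S. Poly_Mapping.lookup a x)"
  unfolding augmentation_def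
  by (rule sum.mono_neutral_left) (use assms in \<open>auto simp: in_keys_iff\<close>)

lemma augmentation_simps:
  "augmentation 0 = 0" "augmentation (frag_of x) = 1"
  "augmentation (a - b) = augmentation a - augmentation b"
  "augmentation (a + b) = augmentation a + augmentation b"
proof -
  let ?S = "Poly_Mapping.keys a \<union> Poly_Mapping.keys b"
  have "augmentation c = (\<Sum>x\<in>?S. Poly_Mapping.lookup c x)" if "c \<in> {a, b, a - b, a + b}" for c
    by (rule augmentation_alt)
      (use that Poly_Mapping.keys_add[of a b] in \<open>auto simp: in_keys_iff lookup_minus\<close>)
  then show "augmentation (a - b) = augmentation a - augmentation b"
    "augmentation (a + b) = augmentation a + augmentation b"
    by (simp_all add: lookup_minus lookup_add sum_subtractf sum.distrib)
qed (simp_all add: augmentation_def)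

lemma augmentation_ring_hom:
  "augmentation \<in> ring_hom (int_group_ring G) int_ring"
proof (rule ring_hom_memI)
  fix a b :: "'a \<Rightarrow>\<^sub>0 int"
  show "augmentation (a \<otimes>\<^bsub>int_group_ring G\<^esub> b) = augmentation a \<otimes>\<^bsub>int_ring\<^esub> augmentation b"
    using subset_UNIV[of "Poly_Mapping.keys a"]
  proof (induction a rule: frag_induction)
    case (one x)
    show ?case using subset_UNIV[of "Poly_Mapping.keys b"]
      by (induction b rule: frag_induction)
        (simp_all add: int_group_ring_mult_0 int_group_ring_mult_diff frag_of_mult augmentation_simps)
  qed (simp_all add: int_group_ring_mult_0 int_group_ring_mult_diff augmentation_simps left_diff_distrib)
qed (simp_all add: int_group_ring_simps augmentation_simps)

lemma subgroup_torsion_subgroup: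
  assumes "comm_group G" shows "subgroup (torsion_subgroup G) G"
proof -
  interpret comm_group G by fact
  show ?thesis
  proof (rule subgroupI)
    show "torsion_subgroup G \<noteq> {}"
      by (auto simp: torsion_subgroup_def intro!: exI[of _ "\<one>\<^bsub>G\<^esub>"] exI[of _ "1::nat"])
  next
    fix x assume "x \<in> torsion_subgroup G"
    then show "inv\<^bsub>G\<^esub> x \<in> torsion_subgroup G"
      by (auto simp: torsion_subgroup_def nat_pow_inv)
  next
    fix x y assume "x \<in> torsion_subgroup G" "y \<in> torsion_subgroup G"
    then obtain m n :: nat where *: "x \<in> carrier G" "y \<in> carrier G" "m > 0" "n > 0"
      "x [^]\<^bsub>G\<^esub> m = \<one>\<^bsub>G\<^esub>" "y [^]\<^bsub>G\<^esub> n = \<one>\<^bsub>G\<^esub>"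
      by (auto simp: torsion_subgroup_def)
    then have "x [^]\<^bsub>G\<^esub> (m * n) = \<one>\<^bsub>G\<^esub>" "y [^]\<^bsub>G\<^esub> (m * n) = \<one>\<^bsub>G\<^esub>"
      by (metis nat_pow_pow nat_pow_one, metis nat_pow_pow nat_pow_one mult.commute)
    then have "(x \<otimes>\<^bsub>G\<^esub> y) [^]\<^bsub>G\<^esub> (m * n) = \<one>\<^bsub>G\<^esub>"
      using * by (simp add: nat_pow_distrib)
    then show "x \<otimes>\<^bsub>G\<^esub> y \<in> torsion_subgroup G"
      using * by (auto simp: torsion_subgroup_def intro!: exI[of _ "m * n"])
  qed (auto simp: torsion_subgroup_def)
qed

end

theory Submission
  imports Defs
begin

text \<open>
  The two groups \<open>\<V>\<^sub>\<omega>(\<int>G)\<close> and \<open>\<V>\<^sub>\<omega>(\<int>T)\<close> are in fact equal (\<open>normalized_units_omega_torsion\<close>),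
  and the equivalence follows at once. The inclusion of \<open>\<V>\<^sub>\<omega>(\<int>T)\<close> in \<open>\<V>\<^sub>\<omega>(\<int>G)\<close> is
  functoriality of the augmentation ideal. For the other one, let \<open>u\<close> be in \<open>\<V>\<^sub>\<omega>(\<int>G)\<close>.

  The support of \<open>u\<close> lies in \<open>T\<close>. To see this, take a homomorphism \<open>wt\<close> to the integers, defined
  on a subgroup generated by \<open>T\<close> and finitely many elements, and grade the group ring of that
  subgroup by it. Units are homogeneous
  (\<open>unit_homogeneous\<close>). The usual proof reduces modulo primes and uses that \<open>\<int>T\<close> has no nontrivial
  idempotents; the proof below uses the involution \<open>g \<mapsto> g\<^sup>-\<^sup>1\<close> instead. Since the coefficient of \<open>1\<close> in
  \<open>a a\<^sup>*\<close> is a sum of squares, the ring is reduced, and \<open>u\<^sup>*\<close> is \<open>u\<close> times a signed group element,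
  so that the extreme homogeneous parts of \<open>u\<close> determine each other, while unless they coincide
  their product has to annihilate \<open>u\<^sup>-\<^sup>1\<close>. The weight of \<open>u\<close> is then read off from the
  derivation \<open>g \<mapsto> wt(g) g\<close>, which followed by the augmentation vanishes on \<open>\<Delta>\<^sup>2\<close>; so \<open>u \<in> 1 + \<Delta>\<^sup>2\<close> has
  weight \<open>0\<close> (\<open>unit_weight_0\<close>). As the weights detect elements of infinite order, the support of \<open>u\<close>
  is torsion.

  It remains to push \<open>u - 1 \<in> \<Delta>\<^sup>n(G)\<close> down to \<open>\<Delta>\<^sup>n(T)\<close>. The membership is witnessed in a
  subgroup \<open>H\<close> generated by \<open>T\<close> and finitely many elements (\<open>augmentation_power_finitary\<close>), and such an
  \<open>H\<close> retracts onto \<open>T\<close> (\<open>torsion_splits_locally\<close>). The retraction fixes \<open>u\<close>, respects the powers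
  of the augmentation ideals, and maps the inverse of \<open>u\<close> to an inverse of \<open>u\<close> in \<open>\<int>T\<close>.
\<close>

section \<open>The involution of an integral group ring\<close>

lemma int_group_ring_mult_add:
  "(a + b) \<otimes>\<^bsub>int_group_ring G\<^esub> c = a \<otimes>\<^bsub>int_group_ring G\<^esub> c + b \<otimes>\<^bsub>int_group_ring G\<^esub> c"
  "c \<otimes>\<^bsub>int_group_ring G\<^esub> (a + b) = c \<otimes>\<^bsub>int_group_ring G\<^esub> a + c \<otimes>\<^bsub>int_group_ring G\<^esub> b"
  by (simp_all add: int_group_ring_simps frag_extend_add frag_extend_fun_add)

lemma int_group_ring_mult_sum:
  "sum f I \<otimes>\<^bsub>int_group_ring G\<^esub> c = (\<Sum>i\<in>I. f i \<otimes>\<^bsub>int_group_ring G\<^esub> c)"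
  "c \<otimes>\<^bsub>int_group_ring G\<^esub> sum f I = (\<Sum>i\<in>I. c \<otimes>\<^bsub>int_group_ring G\<^esub> f i)"
  by (induction I rule: infinite_finite_induct)
    (simp_all add: int_group_ring_mult_0 int_group_ring_mult_add)

lemmas int_group_ring_linear =
  int_group_ring_mult_0 int_group_ring_mult_diff frag_of_mult frag_extend_diff

lemma (in comm_group) cring_int_group_ring: "cring (int_group_ring G)"
proof (intro cring.intro comm_monoid.intro comm_monoid_axioms.intro)
  show "ring (int_group_ring G)"
    by (rule ring_int_group_ring) (rule is_group)
  then show "Group.monoid (int_group_ring G)"
    by (rule ring.is_monoid)
  fix a b assume "a \<in> carrier (int_group_ring G)" "b \<in> carrier (int_group_ring G)"
  then have keys: "Poly_Mapping.keys a \<subseteq> carrier G" "Poly_Mapping.keys b \<subseteq> carrier G"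
    by (simp_all add: int_group_ring_simps)
  from keys(1) show "a \<otimes>\<^bsub>int_group_ring G\<^esub> b = b \<otimes>\<^bsub>int_group_ring G\<^esub> a"
  proof (induction a rule: frag_induction)
    case (one x)
    from keys(2) show ?case
      by (induction b rule: frag_induction) (simp_all add: int_group_ring_linear m_comm one)
  qed (simp_all add: int_group_ring_linear)
qed

lemma frag_push_mult:
  assumes "h \<in> hom G H" "Poly_Mapping.keys a \<subseteq> carrier G" "Poly_Mapping.keys b \<subseteq> carrier G"
  shows "frag_extend (frag_of \<circ> h) (a \<otimes>\<^bsub>int_group_ring G\<^esub> b) =
    frag_extend (frag_of \<circ> h) a \<otimes>\<^bsub>int_group_ring H\<^esub> frag_extend (frag_of \<circ> h) b"
  using assms(2)
proof (induction a rule: frag_induction)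
  case (one x)
  from assms(3) show ?case
    by (induction b rule: frag_induction)
      (simp_all add: int_group_ring_linear hom_mult[OF assms(1) one])
qed (simp_all add: int_group_ring_linear)

lemma keys_frag_push: "Poly_Mapping.keys (frag_extend (frag_of \<circ> h) a) \<subseteq> h ` Poly_Mapping.keys a"
  using keys_frag_extend[of "frag_of \<circ> h" a] by auto

lemma augmentation_frag_push: "augmentation (frag_extend (frag_of \<circ> h) a) = augmentation a"
  using subset_UNIV[of "Poly_Mapping.keys a"]
  by (induction a rule: frag_induction) (simp_all add: frag_extend_diff augmentation_simps)

lemma lookup_frag_extend:
  "Poly_Mapping.lookup (frag_extend f a) x =
    (\<Sum>g\<in>Poly_Mapping.keys a. Poly_Mapping.lookup a g * Poly_Mapping.lookup (f g) x)"
  by (simp add: frag_extend_def lookup_sum)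

context comm_group
begin

abbreviation ring_mult (infixl \<open>\<star>\<close> 70)
  where "a \<star> b \<equiv> a \<otimes>\<^bsub>int_group_ring G\<^esub> b"

abbreviation ZG where "ZG \<equiv> carrier (int_group_ring G)"

abbreviation star where "star \<equiv> frag_extend (frag_of \<circ> m_inv G)"

lemma ZG_iff: "a \<in> ZG \<longleftrightarrow> Poly_Mapping.keys a \<subseteq> carrier G"
  by (simp add: int_group_ring_simps)

lemma ring_mult_closed: "a \<in> ZG \<Longrightarrow> b \<in> ZG \<Longrightarrow> a \<star> b \<in> ZG"
  by (rule int_group_ring_mult_closed) (rule is_group)

lemma ring_mult_assoc: "a \<in> ZG \<Longrightarrow> b \<in> ZG \<Longrightarrow> c \<in> ZG \<Longrightarrow> (a \<star> b) \<star> c = a \<star> (b \<star> c)"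
  by (rule monoid.m_assoc[OF ring.is_monoid[OF ring_int_group_ring[OF is_group]]])

lemma ring_mult_comm: "a \<in> ZG \<Longrightarrow> b \<in> ZG \<Longrightarrow> a \<star> b = b \<star> a"
  by (rule cring.cring_simprules(14)[OF cring_int_group_ring])

lemma ring_mult_one: "a \<in> ZG \<Longrightarrow> frag_of \<one> \<star> a = a" "a \<in> ZG \<Longrightarrow> a \<star> frag_of \<one> = a"
  using ring.ring_simprules(12)[OF ring_int_group_ring[OF is_group]]
    ring_mult_comm[of a "frag_of \<one>"]
  by (auto simp: int_group_ring_simps(1,3))

lemma ring_mult_left_comm: "a \<in> ZG \<Longrightarrow> b \<in> ZG \<Longrightarrow> c \<in> ZG \<Longrightarrow> a \<star> (b \<star> c) = b \<star> (a \<star> c)"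
  by (metis ring_mult_assoc ring_mult_comm)

lemmas ring_mult_ac = ring_mult_assoc ring_mult_comm ring_mult_left_comm ring_mult_closed

lemma star_closed: "a \<in> ZG \<Longrightarrow> star a \<in> ZG"
  using keys_frag_push[of "m_inv G" a] by (auto simp: ZG_iff)

lemma star_mult: "a \<in> ZG \<Longrightarrow> b \<in> ZG \<Longrightarrow> star (a \<star> b) = star a \<star> star b"
  by (rule frag_push_mult) (auto simp: ZG_iff hom_def inv_mult)

lemma star_star: "a \<in> ZG \<Longrightarrow> star (star a) = a"
  unfolding ZG_iff
  by (induction a rule: frag_induction) (simp_all add: frag_extend_diff)

text \<open>
  The coefficient of \<open>\<one>\<close> in \<open>a \<star> star a\<close> is the squared length of \<open>a\<close>. Positivity of this
  quadratic form over the integers is the only arithmetic input of the whole argument: it makes the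
  ring reduced, and it makes an element of squared length \<open>1\<close> a signed group element.
\<close>

lemma lookup_mult_star:
  assumes "a \<in> ZG"
  shows "Poly_Mapping.lookup (a \<star> star a) \<one> = (\<Sum>g\<in>Poly_Mapping.keys a. (Poly_Mapping.lookup a g)\<^sup>2)"
proof -
  have basis: "Poly_Mapping.lookup (frag_of x \<star> star b) \<one> = Poly_Mapping.lookup b x"
    if "x \<in> carrier G" "b \<in> ZG" for x b
    using that(2) unfolding ZG_iff
  proof (induction b rule: frag_induction)
    case (one y)
    then have "x \<otimes> inv y = \<one> \<longleftrightarrow> x = y"
      using that(1) by (metis inv_equality inv_inv inv_closed r_inv)
    then show ?case
      by (auto simp: int_group_ring_linear lookup_single when_def)
  qed (simp_all add: int_group_ring_linear lookup_minus)
  have "Poly_Mapping.lookup (a \<star> star a) \<one> =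
      (\<Sum>g\<in>Poly_Mapping.keys a. Poly_Mapping.lookup a g * Poly_Mapping.lookup (frag_of g \<star> star a) \<one>)"
    by (simp add: int_group_ring_simps lookup_frag_extend)
  also have "\<dots> = (\<Sum>g\<in>Poly_Mapping.keys a. (Poly_Mapping.lookup a g)\<^sup>2)"
    using assms basis[OF _ assms] by (intro sum.cong) (auto simp: ZG_iff power2_eq_square)
  finally show ?thesis .
qed

lemma mult_star_eq_0:
  assumes "a \<in> ZG" "a \<star> star a = 0"
  shows "a = 0"
proof -
  have "(\<Sum>g\<in>Poly_Mapping.keys a. (Poly_Mapping.lookup a g)\<^sup>2) = 0"
    using lookup_mult_star[OF assms(1)] assms(2) by simp
  then have "\<forall>g\<in>Poly_Mapping.keys a. Poly_Mapping.lookup a g = 0"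
    by (subst (asm) sum_nonneg_eq_0_iff) auto
  then show ?thesis
    by (metis in_keys_iff lookup_zero poly_mapping_eqI)
qed

text \<open>
  If \<open>a\<close> squares to \<open>0\<close>, then the self-adjoint element \<open>b = a \<star> star a\<close> satisfies
  \<open>b \<star> star b = b \<star> b = 0\<close>, so that positivity can be used twice, for \<open>b\<close> and then for \<open>a\<close>.
\<close>

lemma ring_reduced:
  assumes "a \<in> ZG" "a \<star> a = 0"
  shows "a = 0"
proof -
  let ?b = "a \<star> star a"
  have *: "star a \<in> ZG" "?b \<in> ZG"
    using assms by (auto intro: star_closed ring_mult_closed)
  have "?b \<star> star ?b = ?b \<star> ?b"
    using assms * by (simp add: star_mult star_star ring_mult_comm)
  also have "\<dots> = (a \<star> a) \<star> (star a \<star> star a)"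
    using assms(1) * by (simp only: ring_mult_ac)
  also have "\<dots> = 0"
    using assms by (simp add: int_group_ring_mult_0)
  finally show ?thesis
    using * assms by (blast intro: mult_star_eq_0)
qed

lemma unitary_singleton:
  assumes "v \<in> ZG" "v \<star> star v = frag_of \<one>"
  shows "\<exists>g. Poly_Mapping.keys v = {g}"
proof -
  let ?k = "Poly_Mapping.keys v"
  have sum: "(\<Sum>g\<in>?k. (Poly_Mapping.lookup v g)\<^sup>2) = 1"
    using lookup_mult_star[OF assms(1)] assms(2) by simp
  have "int (card ?k) = (\<Sum>g\<in>?k. 1)"
    by simp
  also have "\<dots> \<le> (\<Sum>g\<in>?k. (Poly_Mapping.lookup v g)\<^sup>2)"
    by (rule sum_mono) (simp add: in_keys_iff int_one_le_iff_zero_less)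
  finally have "card ?k \<le> 1"
    using sum by simp
  moreover have "?k \<noteq> {}"
    using sum by auto
  ultimately show ?thesis
    by (metis card_1_singleton_iff card_eq_0_iff finite_keys le_neq_implies_less less_one One_nat_def)
qed

text \<open>
  With \<open>w\<close> the inverse of \<open>u\<close>, the element \<open>v = star u \<star> w\<close> satisfies \<open>v \<star> star v = \<one>\<close>. Hence by
  \<open>unitary_singleton\<close> the involution changes a unit only by a signed group element, which forces
  the support of a unit to be symmetric up to a translation.
\<close>

lemma star_unit:
  assumes "u \<in> ZG" "w \<in> ZG" "u \<star> w = frag_of \<one>"
  obtains v where "v \<in> ZG" "star u = v \<star> u" "v \<star> star v = frag_of \<one>"
proof
  let ?v = "star u \<star> w"
  have *: "star u \<in> ZG" "star w \<in> ZG"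
    using assms star_closed by auto
  show "?v \<in> ZG"
    using * assms ring_mult_closed by auto
  have "?v \<star> u = star u \<star> (u \<star> w)"
    using * assms(1,2) by (simp only: ring_mult_ac)
  then show "star u = ?v \<star> u"
    using * assms by (simp add: ring_mult_one)
  have "?v \<star> star ?v = (u \<star> w) \<star> star (u \<star> w)"
    using * assms(1,2) by (simp add: star_mult star_star ring_mult_ac)
  also have "\<dots> = frag_of \<one>"
    by (simp add: assms(3) frag_of_mult)
  finally show "?v \<star> star ?v = frag_of \<one>" .
qed

end

section \<open>Units are homogeneous\<close>

definition homogeneous_part :: "('a \<Rightarrow> int) \<Rightarrow> int \<Rightarrow> ('a \<Rightarrow>\<^sub>0 int) \<Rightarrow> ('a \<Rightarrow>\<^sub>0 int)"
  where "homogeneous_part wt k = frag_extend (\<lambda>g. if wt g = k then frag_of g else 0)"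

lemma homogeneous_part_diff:
  "homogeneous_part wt k (a - b) = homogeneous_part wt k a - homogeneous_part wt k b"
  by (simp add: homogeneous_part_def frag_extend_diff)

lemma homogeneous_part_0: "homogeneous_part wt k 0 = 0"
  by (simp add: homogeneous_part_def)

lemma homogeneous_part_of: "homogeneous_part wt k (frag_of g) = (if wt g = k then frag_of g else 0)"
  by (simp add: homogeneous_part_def)

lemma homogeneous_part_sum:
  "homogeneous_part wt k (sum f I) = (\<Sum>i\<in>I. homogeneous_part wt k (f i))"
  by (induction I rule: infinite_finite_induct)
    (simp_all add: homogeneous_part_def frag_extend_add)

lemma lookup_homogeneous_part:
  "Poly_Mapping.lookup (homogeneous_part wt k a) g = (if wt g = k then Poly_Mapping.lookup a g else 0)"
  using subset_UNIV[of "Poly_Mapping.keys a"]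
  by (induction a rule: frag_induction)
    (auto simp: homogeneous_part_diff homogeneous_part_0 homogeneous_part_of lookup_minus lookup_single when_def)

lemma keys_homogeneous_part:
  "Poly_Mapping.keys (homogeneous_part wt k a) = {g \<in> Poly_Mapping.keys a. wt g = k}"
  by (auto simp: in_keys_iff lookup_homogeneous_part split: if_split_asm)

lemma homogeneous_part_eq_0_iff:
  "homogeneous_part wt k a = 0 \<longleftrightarrow> (\<forall>g\<in>Poly_Mapping.keys a. wt g \<noteq> k)"
  unfolding keys_eq_empty[symmetric] keys_homogeneous_part by blast

lemma sum_homogeneous_part:
  assumes "finite I" "wt ` Poly_Mapping.keys a \<subseteq> I"
  shows "(\<Sum>k\<in>I. homogeneous_part wt k a) = a"
proof (rule poly_mapping_eqI)
  fix g
  show "Poly_Mapping.lookup (\<Sum>k\<in>I. homogeneous_part wt k a) g = Poly_Mapping.lookup a g"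
    using assms by (auto simp: lookup_sum lookup_homogeneous_part image_subset_iff in_keys_iff)
qed

lemma homogeneous_part_uminus:
  "homogeneous_part (\<lambda>g. - wt g) k = homogeneous_part wt (- k)"
  by (simp add: homogeneous_part_def minus_equation_iff eq_commute[of _ "- k"] fun_eq_iff)

text \<open>
  A homomorphism from \<open>G\<close> to the integers turns the group ring into a \<open>\<int>\<close>-graded ring.
\<close>

locale graded_comm_group = comm_group +
  fixes wt :: "'a \<Rightarrow> int"
  assumes wt_mult: "x \<in> carrier G \<Longrightarrow> y \<in> carrier G \<Longrightarrow> wt (x \<otimes> y) = wt x + wt y"
begin

abbreviation part where "part \<equiv> homogeneous_part wt"

lemma wt_one: "wt \<one> = 0"
  using wt_mult[of \<one> \<one>] by simp

lemma wt_inv: "x \<in> carrier G \<Longrightarrow> wt (inv x) = - wt x"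
  using wt_mult[of x "inv x"] by (simp add: wt_one)

lemma part_closed: "a \<in> ZG \<Longrightarrow> part k a \<in> ZG"
  by (auto simp: ZG_iff keys_homogeneous_part)

lemma part_homogeneous_mult:
  assumes "a \<in> ZG" "b \<in> ZG" "\<And>g. g \<in> Poly_Mapping.keys a \<Longrightarrow> wt g = d"
  shows "part k (a \<star> b) = a \<star> part (k - d) b"
proof -
  from assms(1,3) have "Poly_Mapping.keys a \<subseteq> {g \<in> carrier G. wt g = d}"
    by (auto simp: ZG_iff)
  then show ?thesis
  proof (induction a rule: frag_induction)
    case (one x)
    from assms(2) one show ?case
      unfolding ZG_iff
    proof (induction b rule: frag_induction)
      case (one y)
      then show ?case
        by (auto simp: frag_of_mult homogeneous_part_of wt_mult int_group_ring_mult_0)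
    qed (simp_all add: int_group_ring_mult_0 int_group_ring_mult_diff homogeneous_part_0 homogeneous_part_diff)
  qed (simp_all add: int_group_ring_mult_0 int_group_ring_mult_diff homogeneous_part_0 homogeneous_part_diff)
qed

lemma part_mult:
  assumes "a \<in> ZG" "b \<in> ZG" "finite I" "wt ` Poly_Mapping.keys a \<subseteq> I"
  shows "part k (a \<star> b) = (\<Sum>i\<in>I. part i a \<star> part (k - i) b)"
proof -
  have "part k (a \<star> b) = part k ((\<Sum>i\<in>I. part i a) \<star> b)"
    by (simp add: sum_homogeneous_part assms(3,4))
  also have "\<dots> = (\<Sum>i\<in>I. part k (part i a \<star> b))"
    by (simp add: int_group_ring_mult_sum homogeneous_part_sum)
  also have "\<dots> = (\<Sum>i\<in>I. part i a \<star> part (k - i) b)"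
    using assms by (intro sum.cong refl part_homogeneous_mult part_closed)
      (auto simp: keys_homogeneous_part)
  finally show ?thesis .
qed

lemma star_part: "a \<in> ZG \<Longrightarrow> star (part k a) = part (- k) (star a)"
  unfolding ZG_iff
  by (induction a rule: frag_induction)
    (auto simp: homogeneous_part_0 homogeneous_part_diff homogeneous_part_of frag_extend_diff wt_inv)

text \<open>
  In a reduced graded ring the leading part \<open>p\<close> of a unit, of weight \<open>k\<close>, kills every part of the inverse
  of weight above \<open>- k\<close>. The proof goes down through the weights \<open>j\<close>: once \<open>p\<close> kills all parts of
  \<open>w\<close> above \<open>j\<close>, multiplying the part of weight \<open>k + j\<close> of \<open>u \<star> w = \<one>\<close> (which is \<open>0\<close>, since
  \<open>k + j > 0\<close>) by \<open>p\<close> leaves only \<open>p \<star> p \<star> part j w = 0\<close>, and the ring is reduced.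
\<close>

lemma top_part_annihilates:
  assumes uw: "u \<in> ZG" "w \<in> ZG" "u \<star> w = frag_of \<one>"
    and top: "\<And>g. g \<in> Poly_Mapping.keys u \<Longrightarrow> wt g \<le> k"
    and j: "j > - k"
  shows "part k u \<star> part j w = 0"
proof -
  obtain N where N: "\<And>g. g \<in> Poly_Mapping.keys w \<Longrightarrow> wt g < N"
  proof
    show "wt g < Max (insert 0 (wt ` Poly_Mapping.keys w)) + 1" if "g \<in> Poly_Mapping.keys w" for g
      using that Max_ge[of "insert 0 (wt ` Poly_Mapping.keys w)" "wt g"] by simp
  qed
  let ?I = "insert k (wt ` Poly_Mapping.keys u)"
  show ?thesis
    using j
  proof (induction "nat (N - j)" arbitrary: j rule: less_induct)
    case less
    show ?case
    proof (cases "j < N")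
      case False
      then have "part j w = 0"
        using N by (force simp: homogeneous_part_eq_0_iff)
      then show ?thesis
        by (simp add: int_group_ring_mult_0)
    next
      case True
      have closed: "part i u \<in> ZG" "part i w \<in> ZG" for i
        using uw part_closed by auto
      \<comment> \<open>Weights \<open>i < k\<close> of \<open>u\<close> are paired with weights \<open>k + j - i > j\<close> of \<open>w\<close>.\<close>
      have other: "part k u \<star> (part i u \<star> part (k + j - i) w) = 0" if "i \<in> ?I - {k}" for i
      proof -
        from that top have "i < k"
          by force
        then have "part k u \<star> part (k + j - i) w = 0"
          using less.prems True by (intro less.hyps) auto
        moreover have "part k u \<star> (part i u \<star> part (k + j - i) w) =
            part i u \<star> (part k u \<star> part (k + j - i) w)"
          by (intro ring_mult_left_comm closed)
        ultimately show ?thesis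
          by (simp add: int_group_ring_mult_0)
      qed
      have "part (k + j) (u \<star> w) = 0"
        using less.prems uw(3) by (simp add: homogeneous_part_of wt_one)
      then have "(\<Sum>i\<in>?I. part i u \<star> part (k + j - i) w) = 0"
        using part_mult[OF uw(1,2), of ?I "k + j"] by auto
      then have "0 = (\<Sum>i\<in>?I. part k u \<star> (part i u \<star> part (k + j - i) w))"
        by (simp add: int_group_ring_mult_sum(2)[symmetric] int_group_ring_mult_0)
      also have "\<dots> = part k u \<star> (part k u \<star> part j w)"
        using other by (subst sum.remove[of _ k]) auto
      finally have *: "part k u \<star> (part k u \<star> part j w) = 0"
        by simp
      have "(part k u \<star> part j w) \<star> (part k u \<star> part j w) =
          part j w \<star> (part k u \<star> (part k u \<star> part j w))"
        using closed by (simp only: ring_mult_ac)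
      then have "(part k u \<star> part j w) \<star> (part k u \<star> part j w) = 0"
        by (simp add: * int_group_ring_mult_0)
      then show ?thesis
        using closed by (blast intro: ring_reduced[rotated] ring_mult_closed)
    qed
  qed
qed

text \<open>
  Let \<open>k\<close> be the highest and \<open>m\<close> the lowest weight of \<open>u\<close>. By \<open>top_part_annihilates\<close>, used for
  the weight and for its negative, \<open>part k u\<close> kills the parts of \<open>w\<close> of weight above \<open>- k\<close> and
  \<open>part m u\<close> kills those of weight below \<open>- m\<close>. If \<open>m < k\<close>, every weight is of one of these kinds,
  so \<open>part k u \<star> part m u\<close> kills \<open>w\<close> and is \<open>0\<close>. But the relation \<open>star u = v \<star> u\<close> exchanges the
  extreme parts: \<open>star (part k u) = v \<star> part m u\<close>. Hence \<open>part k u \<star> star (part k u) = 0\<close>, and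
  positivity gives \<open>part k u = 0\<close>, against the choice of \<open>k\<close>.
\<close>

lemma unit_homogeneous:
  assumes uw: "u \<in> ZG" "w \<in> ZG" "u \<star> w = frag_of \<one>"
  shows "\<exists>c. \<forall>g\<in>Poly_Mapping.keys u. wt g = c"
proof -
  have "u \<noteq> 0"
    using uw(3) by (auto simp: int_group_ring_mult_0)
  define k where "k = Max (wt ` Poly_Mapping.keys u)"
  have k: "k \<in> wt ` Poly_Mapping.keys u" "\<And>g. g \<in> Poly_Mapping.keys u \<Longrightarrow> wt g \<le> k"
    using \<open>u \<noteq> 0\<close> by (auto simp: k_def intro!: Max_in)
  obtain v where v: "v \<in> ZG" "star u = v \<star> u" "v \<star> star v = frag_of \<one>"
    using star_unit[OF uw] .
  obtain g\<^sub>0 where g\<^sub>0: "Poly_Mapping.keys v = {g\<^sub>0}"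
    using unitary_singleton[OF v(1,3)] by blast
  \<comment> \<open>The weight that corresponds to \<open>k\<close> under the symmetry \<open>star u = v \<star> u\<close> of the support.\<close>
  define m where "m = - k - wt g\<^sub>0"
  have star_part_u: "star (part i u) = v \<star> part (k + m - i) u" for i
    using part_homogeneous_mult[OF v(1) uw(1), of "wt g\<^sub>0" "- i"] g\<^sub>0
    by (simp add: star_part uw(1) v(2) m_def minus_diff_commute diff_diff_eq add.commute)
  have bottom: "m \<le> wt g" if "g \<in> Poly_Mapping.keys u" for g
  proof (rule ccontr)
    assume "\<not> m \<le> wt g"
    then have "part (k + m - wt g) u = 0"
      using k(2) by (fastforce simp: homogeneous_part_eq_0_iff)
    then have "star (part (wt g) u) = v \<star> part (k + m - wt g) u" "part (wt g) u \<noteq> 0"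
      using that by (auto simp: star_part_u homogeneous_part_eq_0_iff)
    then show False
      using star_star[of "part (wt g) u"] part_closed[OF uw(1)]
      by (auto simp: \<open>part (k + m - wt g) u = 0\<close> int_group_ring_mult_0)
  qed
  interpret rev: graded_comm_group G "\<lambda>g. - wt g"
    by unfold_locales (simp add: wt_mult)
  have "k = m"
  proof (rule ccontr)
    assume "k \<noteq> m"
    with k(1) bottom have "m < k"
      by force
    let ?p = "part k u \<star> part m u"
    have closed: "part i u \<in> ZG" "part i w \<in> ZG" for i
      using uw part_closed by auto
    have kill: "?p \<star> part j w = 0" for j
    proof (cases "j > - k")
      case True
      have "?p \<star> part j w = part m u \<star> (part k u \<star> part j w)"
        using closed by (simp only: ring_mult_ac)
      also have "\<dots> = 0"
        by (simp add: top_part_annihilates[OF uw k(2) True] int_group_ring_mult_0)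
      finally show ?thesis .
    next
      case False
      then have "j < - m"
        using \<open>m < k\<close> by simp
      then have "part m u \<star> part j w = 0"
        using rev.top_part_annihilates[OF uw, of "- m" "- j"] bottom
        by (simp add: homogeneous_part_uminus)
      then have "part k u \<star> (part m u \<star> part j w) = 0"
        by (simp add: int_group_ring_mult_0)
      then show ?thesis
        using closed by (simp only: ring_mult_ac)
    qed
    have "?p \<star> w = ?p \<star> (\<Sum>j\<in>wt ` Poly_Mapping.keys w. part j w)"
      by (simp add: sum_homogeneous_part)
    also have "\<dots> = 0"
      by (simp add: int_group_ring_mult_sum kill)
    finally have "(?p \<star> w) \<star> u = 0"
      by (simp add: int_group_ring_mult_0)
    moreover have "(?p \<star> w) \<star> u = ?p \<star> (u \<star> w)"
      using closed uw(1,2) by (simp only: ring_mult_ac)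
    ultimately have "?p = 0"
      using closed uw by (simp add: ring_mult_one ring_mult_closed)
    have "part k u \<star> star (part k u) = part k u \<star> (v \<star> part m u)"
      by (simp add: star_part_u)
    also have "\<dots> = v \<star> ?p"
      using closed v(1) by (simp only: ring_mult_ac)
    finally have "part k u = 0"
      using mult_star_eq_0[OF closed(1)] by (simp add: \<open>?p = 0\<close> int_group_ring_mult_0)
    then show False
      using k(1) by (auto simp: homogeneous_part_eq_0_iff)
  qed
  with k(2) bottom show ?thesis
    by (intro exI[of _ k]) (auto intro: antisym)
qed

end

section \<open>Powers of the augmentation ideal\<close>

lemma augmentation_power_0: "augmentation_power G 0 = carrier (int_group_ring G)"
  by (simp add: augmentation_power_def ideals_set_def)

lemma augmentation_power_Suc:
  "augmentation_power G (Suc n) =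
    ideal_prod (int_group_ring G) (augmentation_power G n) (augmentation_ideal G)"
  by (simp add: augmentation_power_def ideals_set_def)

lemma augmentation_ideal_iff:
  "a \<in> augmentation_ideal G \<longleftrightarrow> Poly_Mapping.keys a \<subseteq> carrier G \<and> augmentation a = 0"
  by (auto simp: augmentation_ideal_def a_kernel_def' int_group_ring_simps)

lemma augmentation_power_closed:
  assumes "group G" "a \<in> augmentation_power G n"
  shows "a \<in> carrier (int_group_ring G)"
  using assms(2)
proof (induction n arbitrary: a)
  case 0
  then show ?case by (simp add: augmentation_power_0)
next
  case (Suc n)
  interpret R: ring "int_group_ring G"
    using assms(1) by (rule ring_int_group_ring)
  from Suc.prems show ?case
    unfolding augmentation_power_Suc
  proof (induction rule: ideal_prod.induct)
    case (prod i j)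
    then show ?case
      using Suc.IH[of i] by (intro R.m_closed) (auto simp: augmentation_ideal_iff int_group_ring_simps)
  qed (rule R.a_closed)
qed

lemma normalized_units_filt_iff:
  "u \<in> normalized_units_filt G n \<longleftrightarrow>
    u \<in> normalized_units G \<and> u - frag_of \<one>\<^bsub>G\<^esub> \<in> augmentation_power G n"
  by (force simp: normalized_units_filt_def a_l_coset_def' int_group_ring_simps)

lemma frag_push_closed:
  assumes "h \<in> hom G H" "Poly_Mapping.keys a \<subseteq> carrier G"
  shows "Poly_Mapping.keys (frag_extend (frag_of \<circ> h) a) \<subseteq> carrier H"
  using assms(2) by (intro order_trans[OF keys_frag_push]) (auto intro: hom_in_carrier[OF assms(1)])

lemma frag_push_augmentation_power:
  assumes "group G" and h: "h \<in> hom G H" and a: "a \<in> augmentation_power G n"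
  shows "frag_extend (frag_of \<circ> h) a \<in> augmentation_power H n"
  using a
proof (induction n arbitrary: a)
  case 0
  then show ?case
    using frag_push_closed[OF h, of a]
    unfolding augmentation_power_0 int_group_ring_simps(1) by blast
next
  case (Suc n)
  from Suc.prems show ?case
    unfolding augmentation_power_Suc
  proof (induction rule: ideal_prod.induct)
    case (prod i j)
    have "Poly_Mapping.keys i \<subseteq> carrier G" "Poly_Mapping.keys j \<subseteq> carrier G"
      using prod augmentation_power_closed[OF assms(1)]
      by (auto simp: int_group_ring_simps augmentation_ideal_iff)
    moreover have "frag_extend (frag_of \<circ> h) j \<in> augmentation_ideal H"
      using prod(2) frag_push_closed[OF h] by (simp add: augmentation_ideal_iff augmentation_frag_push)
    ultimately show ?case
      using prod(1) by (subst frag_push_mult[OF h]) (blast intro: ideal_prod.prod Suc.IH)+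
  next
    case (sum s t)
    then have "frag_extend (frag_of \<circ> h) s \<oplus>\<^bsub>int_group_ring H\<^esub> frag_extend (frag_of \<circ> h) t
        \<in> ideal_prod (int_group_ring H) (augmentation_power H n) (augmentation_ideal H)"
      by (intro ideal_prod.sum)
    then show ?case
      by (simp only: int_group_ring_simps(5) frag_extend_add)
  qed
qed

lemma int_group_ring_subgroup_mult:
  "a \<otimes>\<^bsub>int_group_ring (G\<lparr>carrier := H\<rparr>)\<^esub> b = a \<otimes>\<^bsub>int_group_ring G\<^esub> b"
  by (simp add: int_group_ring_simps)

text \<open>
  Only finitely many group elements occur in an expression of \<open>a\<close> as a sum of products of elements
  of the augmentation ideal. So membership in a power of the ideal is already witnessed in a subgroup
  that is finitely generated modulo torsion, where the torsion subgroup splits off.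
\<close>

lemma augmentation_power_finitary:
  assumes "a \<in> augmentation_power G n"
  shows "\<exists>S. finite S \<and> S \<subseteq> carrier G \<and>
    (\<forall>H. S \<subseteq> H \<longrightarrow> a \<in> augmentation_power (G\<lparr>carrier := H\<rparr>) n)"
  using assms
proof (induction n arbitrary: a)
  case 0
  then show ?case
    by (intro exI[of _ "Poly_Mapping.keys a"]) (simp add: augmentation_power_0 int_group_ring_simps)
next
  case (Suc n)
  from Suc.prems show ?case
    unfolding augmentation_power_Suc
  proof (induction rule: ideal_prod.induct)
    case (prod i j)
    from Suc.IH[OF prod(1)] obtain S where S: "finite S" "S \<subseteq> carrier G"
      "\<And>H. S \<subseteq> H \<Longrightarrow> i \<in> augmentation_power (G\<lparr>carrier := H\<rparr>) n"
      by blast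
    show ?case
    proof (intro exI[of _ "S \<union> Poly_Mapping.keys j"] conjI allI impI)
      fix H assume "S \<union> Poly_Mapping.keys j \<subseteq> H"
      then have "i \<otimes>\<^bsub>int_group_ring (G\<lparr>carrier := H\<rparr>)\<^esub> j \<in> ideal_prod (int_group_ring (G\<lparr>carrier := H\<rparr>))
          (augmentation_power (G\<lparr>carrier := H\<rparr>) n) (augmentation_ideal (G\<lparr>carrier := H\<rparr>))"
        using prod(2) by (intro ideal_prod.prod S(3)) (auto simp: augmentation_ideal_iff)
      then show "i \<otimes>\<^bsub>int_group_ring G\<^esub> j \<in> ideal_prod (int_group_ring (G\<lparr>carrier := H\<rparr>))
          (augmentation_power (G\<lparr>carrier := H\<rparr>) n) (augmentation_ideal (G\<lparr>carrier := H\<rparr>))"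
        by (simp only: int_group_ring_subgroup_mult)
    qed (use S prod(2) in \<open>auto simp: augmentation_ideal_iff\<close>)
  next
    case (sum s t)
    then obtain S S' where S: "finite S" "S \<subseteq> carrier G" "finite S'" "S' \<subseteq> carrier G"
      "\<And>H. S \<subseteq> H \<Longrightarrow> s \<in> ideal_prod (int_group_ring (G\<lparr>carrier := H\<rparr>))
          (augmentation_power (G\<lparr>carrier := H\<rparr>) n) (augmentation_ideal (G\<lparr>carrier := H\<rparr>))"
      "\<And>H. S' \<subseteq> H \<Longrightarrow> t \<in> ideal_prod (int_group_ring (G\<lparr>carrier := H\<rparr>))
          (augmentation_power (G\<lparr>carrier := H\<rparr>) n) (augmentation_ideal (G\<lparr>carrier := H\<rparr>))"
      by blast
    show ?case
    proof (intro exI[of _ "S \<union> S'"] conjI allI impI)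
      fix H assume "S \<union> S' \<subseteq> H"
      then have "s \<oplus>\<^bsub>int_group_ring (G\<lparr>carrier := H\<rparr>)\<^esub> t \<in> ideal_prod (int_group_ring (G\<lparr>carrier := H\<rparr>))
          (augmentation_power (G\<lparr>carrier := H\<rparr>) n) (augmentation_ideal (G\<lparr>carrier := H\<rparr>))"
        by (intro ideal_prod.sum S(5,6)) auto
      then show "s \<oplus>\<^bsub>int_group_ring G\<^esub> t \<in> ideal_prod (int_group_ring (G\<lparr>carrier := H\<rparr>))
          (augmentation_power (G\<lparr>carrier := H\<rparr>) n) (augmentation_ideal (G\<lparr>carrier := H\<rparr>))"
        by (simp only: int_group_ring_simps)
    qed (use S in auto)
  qed
qed

lemma augmentation_power_augmentation:
  assumes "group G" "a \<in> augmentation_power G (Suc n)"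
  shows "augmentation a = 0"
  using assms(2) unfolding augmentation_power_Suc
proof (induction rule: ideal_prod.induct)
  case (prod i j)
  then have "augmentation (i \<otimes>\<^bsub>int_group_ring G\<^esub> j) = augmentation i \<otimes>\<^bsub>int_ring\<^esub> augmentation j"
    using augmentation_power_closed[OF assms(1), of i n]
    by (intro ring_hom_mult[OF augmentation_ring_hom])
      (auto simp: augmentation_ideal_iff int_group_ring_simps(1))
  with prod(2) show ?case
    by (simp add: augmentation_ideal_iff)
qed (simp add: int_group_ring_simps(5) augmentation_simps)

text \<open>
  When \<open>wt\<close> is a homomorphism to the integers, this is the Euler derivation of the associated
  grading.
\<close>

definition weight_derivation :: "('a \<Rightarrow> int) \<Rightarrow> ('a \<Rightarrow>\<^sub>0 int) \<Rightarrow> ('a \<Rightarrow>\<^sub>0 int)"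
  where "weight_derivation wt = frag_extend (\<lambda>g. frag_cmul (wt g) (frag_of g))"

lemma augmentation_frag_cmul: "augmentation (frag_cmul c a) = c * augmentation a"
  by (subst augmentation_alt[of "Poly_Mapping.keys a"])
    (auto simp: augmentation_def sum_distrib_left keys_cmul)

lemma weight_derivation_homogeneous:
  assumes "\<And>g. g \<in> Poly_Mapping.keys a \<Longrightarrow> wt g = c"
  shows "weight_derivation wt a = frag_cmul c a"
proof -
  have "weight_derivation wt a = frag_extend (\<lambda>g. frag_cmul c (frag_of g)) a"
    unfolding weight_derivation_def by (rule frag_extend_eq) (simp add: assms)
  also have "\<dots> = frag_cmul c (frag_extend frag_of a)"
    by (simp add: frag_extend_def frag_cmul_sum mult.commute)
  finally show ?thesis
    by (simp add: frag_expansion[symmetric])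
qed

lemma frag_cmul_mult:
  "frag_cmul c a \<otimes>\<^bsub>int_group_ring G\<^esub> b = frag_cmul c (a \<otimes>\<^bsub>int_group_ring G\<^esub> b)"
  "a \<otimes>\<^bsub>int_group_ring G\<^esub> frag_cmul c b = frag_cmul c (a \<otimes>\<^bsub>int_group_ring G\<^esub> b)"
  by (simp_all add: int_group_ring_simps frag_extend_cmul)
    (simp add: frag_extend_def frag_cmul_sum mult.left_commute)

context graded_comm_group
begin

lemma weight_derivation_closed: "a \<in> ZG \<Longrightarrow> weight_derivation wt a \<in> ZG"
  using keys_frag_extend[of "\<lambda>g. frag_cmul (wt g) (frag_of g)" a]
  by (fastforce simp: weight_derivation_def ZG_iff)

lemma weight_derivation_mult:
  assumes "a \<in> ZG" "b \<in> ZG"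
  shows "weight_derivation wt (a \<star> b) = weight_derivation wt a \<star> b + a \<star> weight_derivation wt b"
  using assms(1) unfolding ZG_iff
proof (induction a rule: frag_induction)
  case (one x)
  from assms(2) show ?case
    unfolding ZG_iff
  proof (induction b rule: frag_induction)
    case (one y)
    with \<open>x \<in> carrier G\<close> show ?case
      by (simp add: weight_derivation_def frag_of_mult frag_cmul_mult wt_mult frag_cmul_distrib)
  qed (simp_all add: weight_derivation_def int_group_ring_linear)
qed (simp_all add: weight_derivation_def int_group_ring_linear)

text \<open>
  By the product rule, a derivation sends a product of two elements of the augmentation ideal back
  into that ideal. Thus the squared ideal detects the weight of a homogeneous element, as used in
  \<open>unit_weight_0\<close>.
\<close>

lemma augmentation_weight_derivation_eq_0:
  assumes "a \<in> augmentation_power G 2"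
  shows "augmentation (weight_derivation wt a) = 0"
proof -
  have "a \<in> ideal_prod (int_group_ring G) (augmentation_power G (Suc 0)) (augmentation_ideal G)"
    using assms by (simp add: augmentation_power_Suc numeral_2_eq_2)
  then show ?thesis
  proof (induction rule: ideal_prod.induct)
    case (prod i j)
    have "i \<in> ZG" "j \<in> ZG"
      using prod augmentation_power_closed[OF is_group] by (auto simp: ZG_iff augmentation_ideal_iff)
    moreover have "weight_derivation wt i \<in> ZG" "weight_derivation wt j \<in> ZG"
      using calculation by (auto intro: weight_derivation_closed)
    moreover have "augmentation i = 0" "augmentation j = 0"
      using prod augmentation_power_augmentation[OF is_group] by (auto simp: augmentation_ideal_iff)
    ultimately show ?case
      by (simp add: weight_derivation_mult augmentation_simps ring_hom_mult[OF augmentation_ring_hom])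
  next
    case (sum s t)
    then show ?case
      by (simp add: weight_derivation_def int_group_ring_simps(5) frag_extend_add augmentation_simps)
  qed
qed

lemma unit_weight_0:
  assumes uw: "u \<in> ZG" "w \<in> ZG" "u \<star> w = frag_of \<one>"
    and aug: "augmentation u = 1" and u: "u - frag_of \<one> \<in> augmentation_power G 2"
    and g: "g \<in> Poly_Mapping.keys u"
  shows "wt g = 0"
proof -
  obtain c where c: "\<And>g. g \<in> Poly_Mapping.keys u \<Longrightarrow> wt g = c"
    using unit_homogeneous[OF uw] by blast
  have "c = augmentation (weight_derivation wt u)"
    by (simp add: weight_derivation_homogeneous[OF c] augmentation_frag_cmul aug)
  also have "\<dots> = augmentation (weight_derivation wt (u - frag_of \<one>))"
    by (simp add: weight_derivation_def frag_extend_diff wt_one)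
  also have "\<dots> = 0"
    using u by (rule augmentation_weight_derivation_eq_0)
  finally show ?thesis
    using c[OF g] by simp
qed

end

section \<open>Splitting off the torsion subgroup\<close>

context comm_group
begin

lemma comm_group_subgroup:
  assumes "subgroup H G"
  shows "comm_group (G\<lparr>carrier := H\<rparr>)"
  using subgroup_imp_group[OF assms] subgroup.mem_carrier[OF assms]
  by (intro group.group_comm_groupI) (auto intro: m_comm)

abbreviation T where "T \<equiv> torsion_subgroup G"

lemma torsion_subgroup: "subgroup T G"
  by (rule subgroup_torsion_subgroup) (rule comm_group_axioms)

lemma torsion_root:
  assumes "x \<in> carrier G" "x [^] (n::int) \<in> T" "n \<noteq> 0"
  shows "x \<in> T"
proof -
  from assms(2) obtain m :: nat where m: "m > 0" "(x [^] n) [^] m = \<one>"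
    by (auto simp: torsion_subgroup_def)
  then have "x [^] (n * int m) = \<one>"
    using assms(1) by (simp add: int_pow_pow[symmetric] int_pow_int)
  then have "x [^] \<bar>n * int m\<bar> = \<one>"
    using assms(1) by (cases "n * int m \<ge> 0") (simp_all add: int_pow_neg abs_if)
  then have "x [^] nat \<bar>n * int m\<bar> = \<one>"
    by (simp add: int_pow_int[symmetric])
  moreover have "nat \<bar>n * int m\<bar> > 0"
    using m(1) assms(3) by simp
  ultimately show ?thesis
    using assms(1) unfolding torsion_subgroup_def by blast
qed

text \<open>
  Families of generators are indexed by a set, so that superfluous ones can be dropped without
  renumbering the others.
\<close>

definition power_product :: "('i \<Rightarrow> 'a) \<Rightarrow> ('i \<Rightarrow> int) \<Rightarrow> 'i set \<Rightarrow> 'a"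
  where "power_product x d I = (\<Otimes>i\<in>I. x i [^] d i)"

lemma power_product_closed: "x \<in> I \<rightarrow> carrier G \<Longrightarrow> power_product x d I \<in> carrier G"
  by (auto simp: power_product_def intro!: finprod_closed)

lemma power_product_add:
  assumes "x \<in> I \<rightarrow> carrier G"
  shows "power_product x (\<lambda>i. c i + d i) I = power_product x c I \<otimes> power_product x d I"
proof -
  have "power_product x (\<lambda>i. c i + d i) I = (\<Otimes>i\<in>I. x i [^] c i \<otimes> x i [^] d i)"
    unfolding power_product_def using assms
    by (intro finprod_cong') (auto simp: int_pow_mult Pi_iff)
  then show ?thesis
    using assms by (subst (asm) finprod_multf) (auto simp: power_product_def)
qed

lemma power_product_cong:
  assumes "x \<in> I \<rightarrow> carrier G" "\<And>i. i \<in> I \<Longrightarrow> x i = y i" "\<And>i. i \<in> I \<Longrightarrow> c i = d i"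
  shows "power_product x c I = power_product y d I"
  unfolding power_product_def using assms by (intro finprod_cong') (auto simp: Pi_iff)

lemma power_product_remove:
  assumes "finite I" "i \<in> I" "x \<in> I \<rightarrow> carrier G"
  shows "power_product x d I = x i [^] d i \<otimes> power_product x d (I - {i})"
proof -
  have "power_product x d (insert i (I - {i})) = x i [^] d i \<otimes> power_product x d (I - {i})"
    unfolding power_product_def using assms by (intro finprod_insert) auto
  then show ?thesis
    using assms(2) by (simp add: insert_absorb)
qed

lemma power_product_remove2:
  assumes "finite I" "i \<in> I" "j \<in> I" "i \<noteq> j" "x \<in> I \<rightarrow> carrier G"
  shows "power_product x d I = x i [^] d i \<otimes> (x j [^] d j \<otimes> power_product x d (I - {i} - {j}))"
proof -
  have "power_product x d (I - {i}) = x j [^] d j \<otimes> power_product x d (I - {i} - {j})"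
    using assms by (intro power_product_remove) auto
  with assms show ?thesis
    by (simp add: power_product_remove[of I i])
qed

lemma power_product_exchange:
  assumes I: "finite I" "i \<in> I" "j \<in> I" "i \<noteq> j" and x: "x \<in> I \<rightarrow> carrier G"
  shows "power_product x c I =
    power_product (x(j := x j \<otimes> x i [^] e)) (c(i := c i - e * c j)) I" (is "_ = power_product ?y ?d I")
proof -
  let ?P = "power_product x c (I - {i} - {j})"
  have xij: "x i \<in> carrier G" "x j \<in> carrier G"
    using I x by auto
  have P: "?P \<in> carrier G" and Q: "power_product ?y ?d (I - {i} - {j}) = ?P"
    using x I by (auto intro!: power_product_closed power_product_cong)
  have "power_product ?y ?d I = ?y i [^] ?d i \<otimes> (?y j [^] ?d j \<otimes> power_product ?y ?d (I - {i} - {j}))"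
    using I x xij by (intro power_product_remove2) (auto simp: Pi_iff)
  also have "\<dots> = x i [^] (c i - e * c j) \<otimes> ((x j \<otimes> x i [^] e) [^] c j \<otimes> ?P)"
    using I(4) by (simp only: Q) simp
  also have "\<dots> = (x i [^] (c i - e * c j) \<otimes> x i [^] (e * c j)) \<otimes> (x j [^] c j \<otimes> ?P)"
    using xij P by (simp add: int_pow_distrib int_pow_pow m_ac)
  also have "x i [^] (c i - e * c j) \<otimes> x i [^] (e * c j) = x i [^] c i"
    using xij by (simp add: int_pow_mult[symmetric])
  also have "x i [^] c i \<otimes> (x j [^] c j \<otimes> ?P) = power_product x c I"
    using power_product_remove2[OF I x, of c] by simp
  finally show ?thesis ..
qed

text \<open>
  Euclidean algorithm on the exponents of a relation modulo torsion. While two exponents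
  \<open>c i\<close>, \<open>c j\<close> with \<open>\<bar>c j\<bar> \<le> \<bar>c i\<bar>\<close> are nonzero, replacing the generator \<open>x j\<close> by \<open>x j \<otimes> x i\<close> or
  \<open>x j \<otimes> inv (x i)\<close> keeps the span and lowers \<open>\<bar>c i\<bar>\<close>. When a single exponent is left, a nonzero
  power of one generator is torsion; this generator is itself torsion and can be dropped.
\<close>

lemma dependent_generators_shrink:
  assumes I: "finite I" and x: "x \<in> I \<rightarrow> carrier G"
    and rel: "power_product x c I \<in> T" "\<exists>i\<in>I. c i \<noteq> 0"
  shows "\<exists>i\<in>I. \<exists>y\<in>I - {i} \<rightarrow> carrier G. \<forall>d. \<exists>t\<in>T. \<exists>e.
    power_product x d I = t \<otimes> power_product y e (I - {i})"
  using x rel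
proof (induction "nat (\<Sum>i\<in>I. \<bar>c i\<bar>)" arbitrary: x c rule: less_induct)
  case less
  interpret T: subgroup T G
    by (rule torsion_subgroup)
  show ?case
  proof (cases "\<exists>i\<in>I. \<exists>j\<in>I. i \<noteq> j \<and> c i \<noteq> 0 \<and> c j \<noteq> 0")
    case True
    then obtain i j where ij: "i \<in> I" "j \<in> I" "i \<noteq> j" "c i \<noteq> 0" "c j \<noteq> 0" "\<bar>c j\<bar> \<le> \<bar>c i\<bar>"
      by (metis linear)
    \<comment> \<open>The sign for which \<open>c i - e * c j\<close> is closer to \<open>0\<close> than \<open>c i\<close>.\<close>
    define e where "e = sgn (c i) * sgn (c j)"
    let ?y = "x(j := x j \<otimes> x i [^] e)" and ?c = "\<lambda>c. c(i := c i - e * c j)"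
    have exch: "power_product x d I = power_product ?y (?c d) I" for d
      by (rule power_product_exchange) (use ij I less.prems in auto)
    have "\<bar>c i - e * c j\<bar> < \<bar>c i\<bar>"
      using ij(4-6) by (auto simp: e_def sgn_if split: if_splits)
    then have "(\<Sum>k\<in>I. \<bar>?c c k\<bar>) < (\<Sum>k\<in>I. \<bar>c k\<bar>)"
      using ij(1,3) I by (intro sum_strict_mono_ex1) auto
    moreover have "(\<Sum>k\<in>I. \<bar>?c c k\<bar>) \<ge> 0"
      by (rule sum_nonneg) simp
    ultimately have "nat (\<Sum>k\<in>I. \<bar>?c c k\<bar>) < nat (\<Sum>k\<in>I. \<bar>c k\<bar>)"
      by (simp only: nat_less_eq_zless)
    moreover have "?y \<in> I \<rightarrow> carrier G"
      using less.prems(1) ij by (auto simp: Pi_iff)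
    moreover have "power_product ?y (?c c) I \<in> T"
      using less.prems(2) by (simp only: exch[symmetric])
    moreover have "\<exists>k\<in>I. ?c c k \<noteq> 0"
      using ij by (intro bexI[of _ j]) auto
    ultimately obtain k y where k: "k \<in> I" "y \<in> I - {k} \<rightarrow> carrier G"
      "\<forall>d. \<exists>t\<in>T. \<exists>e. power_product ?y d I = t \<otimes> power_product y e (I - {k})"
      using less.hyps by meson
    show ?thesis
      using k(1,2) k(3)[rule_format, of "?c _"] by (auto simp: exch)
  next
    case False
    with less.prems(3) obtain i where i: "i \<in> I" "c i \<noteq> 0" "\<And>j. j \<in> I - {i} \<Longrightarrow> c j = 0"
      by blast
    have xi: "x i \<in> carrier G"
      using i(1) less.prems(1) by blast
    have "power_product x c (I - {i}) = \<one>"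
      unfolding power_product_def by (rule finprod_one_eqI) (simp add: i(3))
    then have "power_product x c I = x i [^] c i"
      using I i(1) less.prems(1) xi by (simp add: power_product_remove)
    then have "x i \<in> T"
      using less.prems(2) i(2) xi by (auto intro: torsion_root)
    then have "\<exists>t\<in>T. \<exists>e. power_product x d I = t \<otimes> power_product x e (I - {i})" for d
      using I i(1) less.prems(1) subgroup_int_pow_closed[OF torsion_subgroup]
      by (auto simp: power_product_remove)
    then show ?thesis
      using i(1) less.prems(1) by (intro bexI[of _ i] bexI[of _ x]) auto
  qed
qed

lemma independent_generators:
  fixes I :: "'i set"
  assumes I: "finite I" and x: "x \<in> I \<rightarrow> carrier G"
  shows "\<exists>J (y :: 'i \<Rightarrow> 'a). finite J \<and> y \<in> J \<rightarrow> carrier G \<and>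
    (\<forall>d. \<exists>t\<in>T. \<exists>e. power_product x d I = t \<otimes> power_product y e J) \<and>
    (\<forall>c. power_product y c J \<in> T \<longrightarrow> (\<forall>i\<in>J. c i = 0))"
  using I x
proof (induction I arbitrary: x rule: finite_psubset_induct)
  case (psubset I)
  interpret T: subgroup T G
    by (rule torsion_subgroup)
  show ?case
  proof (cases "\<forall>c. power_product x c I \<in> T \<longrightarrow> (\<forall>i\<in>I. c i = 0)")
    case True
    have "\<exists>t\<in>T. \<exists>e. power_product x d I = t \<otimes> power_product x e I" for d
      using power_product_closed[OF psubset.prems] by (metis T.one_closed l_one)
    then show ?thesis
      using True psubset.hyps psubset.prems by - (rule exI[of _ I], rule exI[of _ x], simp)
  next
    case False
    then obtain c where "power_product x c I \<in> T" "\<exists>i\<in>I. c i \<noteq> 0"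
      by auto
    from dependent_generators_shrink[OF psubset.hyps psubset.prems this]
    obtain i y where y: "i \<in> I" "y \<in> I - {i} \<rightarrow> carrier G"
      "\<forall>d. \<exists>t\<in>T. \<exists>e. power_product x d I = t \<otimes> power_product y e (I - {i})"
      by (elim bexE) (rule that)
    have "I - {i} \<subset> I"
      using y(1) by blast
    from psubset.IH[OF this y(2)] obtain J and z :: "'i \<Rightarrow> 'a" where z: "finite J" "z \<in> J \<rightarrow> carrier G"
      "\<forall>d. \<exists>t\<in>T. \<exists>e. power_product y d (I - {i}) = t \<otimes> power_product z e J"
      "\<forall>c. power_product z c J \<in> T \<longrightarrow> (\<forall>i\<in>J. c i = 0)"
      by (elim exE conjE) (rule that)
    have "\<exists>t\<in>T. \<exists>e. power_product x d I = t \<otimes> power_product z e J" for d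
    proof -
      obtain t e where t: "t \<in> T" "power_product x d I = t \<otimes> power_product y e (I - {i})"
        using y(3) by blast
      obtain s f where s: "s \<in> T" "power_product y e (I - {i}) = s \<otimes> power_product z f J"
        using z(3) by blast
      have "power_product x d I = (t \<otimes> s) \<otimes> power_product z f J"
        using t s power_product_closed[OF z(2)] by (simp add: m_assoc)
      then show ?thesis
        using t(1) s(1) by blast
    qed
    with z(1,2,4) show ?thesis
      by - (rule exI[of _ J], rule exI[of _ z], simp)
  qed
qed

text \<open>
  An abelian group that is finitely generated modulo its torsion subgroup is the direct product of
  that subgroup and a free group. This applies to the subgroup \<open>H\<close> that is spanned by \<open>T\<close> and
  independent generators obtained from \<open>S\<close>: as the generators are
  independent modulo \<open>T\<close>, every element of \<open>H\<close> has a unique torsion factor and unique exponents.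
  The torsion factor is the retraction \<open>\<rho>\<close>, and the exponents are the integral weights that tell
  elements outside \<open>T\<close> from the torsion. The group \<open>G\<close> itself need not have such a retraction, nor
  any nonzero weight (\<open>G\<close> may be divisible), so passing to \<open>H\<close> is essential.
\<close>

lemma torsion_splits_locally:
  assumes S: "finite S" "S \<subseteq> carrier G"
  obtains H \<rho> where "subgroup H G" "S \<subseteq> H" "T \<subseteq> H"
    "\<rho> \<in> hom (G\<lparr>carrier := H\<rparr>) (G\<lparr>carrier := T\<rparr>)" "\<And>t. t \<in> T \<Longrightarrow> \<rho> t = t"
    "\<And>h. h \<in> H \<Longrightarrow> h \<notin> T \<Longrightarrow> \<exists>wt. graded_comm_group (G\<lparr>carrier := H\<rparr>) wt \<and> wt h \<noteq> 0"
proof -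
  interpret T: subgroup T G
    by (rule torsion_subgroup)
  have "(\<lambda>g. g) \<in> S \<rightarrow> carrier G"
    using S(2) by auto
  from independent_generators[OF S(1) this]
  obtain J :: "'a set" and x where J: "finite J" and x: "x \<in> J \<rightarrow> carrier G"
    and span: "\<And>d. \<exists>t\<in>T. \<exists>e. power_product (\<lambda>g. g) d S = t \<otimes> power_product x e J"
    and indep: "\<forall>c. power_product x c J \<in> T \<longrightarrow> (\<forall>i\<in>J. c i = 0)"
    by (elim exE conjE) (rule that, auto)
  note pp = power_product_closed[OF x]
  define H where "H = {t \<otimes> power_product x e J | t e. t \<in> T}"
  have pp_0: "power_product x (\<lambda>i. 0) J = \<one>"
    unfolding power_product_def by (rule finprod_one_eqI) simp
  have unique: "t = s \<and> (\<forall>i\<in>J. d i = e i)"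
    if eq: "t \<otimes> power_product x d J = s \<otimes> power_product x e J" and ts: "t \<in> T" "s \<in> T" for t s d e
  proof -
    have "power_product x (\<lambda>i. (d i - e i) + e i) J = (inv t \<otimes> s) \<otimes> power_product x e J"
      using eq ts pp by (simp add: m_assoc) (metis T.mem_carrier inv_solve_left m_closed)
    then have "power_product x (\<lambda>i. d i - e i) J = inv t \<otimes> s"
      using ts pp by (subst (asm) power_product_add[OF x]) auto
    also have "\<dots> \<in> T"
      using ts by blast
    finally have *: "\<forall>i\<in>J. d i - e i = 0"
      using indep by blast
    then have "power_product x d J = power_product x e J"
      by (intro power_product_cong x) auto
    with eq ts pp * show ?thesis
      by auto
  qed
  have mult: "(t \<otimes> power_product x d J) \<otimes> (s \<otimes> power_product x e J) =
      (t \<otimes> s) \<otimes> power_product x (\<lambda>i. d i + e i) J" if "t \<in> T" "s \<in> T" for t s d e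
    using that pp by (simp add: power_product_add[OF x] m_ac)
  have T_sub: "T \<subseteq> H"
  proof
    fix t assume "t \<in> T"
    then have "t = t \<otimes> power_product x (\<lambda>i. 0) J"
      by (simp add: pp_0)
    with \<open>t \<in> T\<close> show "t \<in> H"
      unfolding H_def by blast
  qed
  have sub: "subgroup H G"
  proof (rule subgroupI)
    show "H \<subseteq> carrier G"
      using pp by (auto simp: H_def)
    show "H \<noteq> {}"
      using T_sub T.one_closed by blast
  next
    fix h assume "h \<in> H"
    then obtain t e where h: "h = t \<otimes> power_product x e J" "t \<in> T"
      by (auto simp: H_def)
    have "(inv t \<otimes> power_product x (\<lambda>i. - e i) J) \<otimes> h = \<one>"
      using h(2) by (simp add: h(1) mult pp_0)
    then have "inv h = inv t \<otimes> power_product x (\<lambda>i. - e i) J"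
      using h pp by (intro inv_equality) auto
    then show "inv h \<in> H"
      using h(2) unfolding H_def by blast
  next
    fix h k assume "h \<in> H" "k \<in> H"
    then show "h \<otimes> k \<in> H"
      unfolding H_def using mult by force
  qed
  have "S \<subseteq> H"
  proof
    fix g assume g: "g \<in> S"
    have "power_product (\<lambda>g. g) (\<lambda>i. if i = g then 1 else 0) (S - {g}) = \<one>"
      unfolding power_product_def by (rule finprod_one_eqI) simp
    then have "power_product (\<lambda>g. g) (\<lambda>i. if i = g then 1 else 0) S = g"
      using S g by (subst power_product_remove[of _ g]) auto
    then show "g \<in> H"
      using span[of "\<lambda>i. if i = g then 1 else 0"] by (auto simp: H_def)
  qed
  have "\<forall>h\<in>H. \<exists>p. h = fst p \<otimes> power_product x (snd p) J \<and> fst p \<in> T"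
    by (auto simp: H_def)
  then obtain p where p: "\<forall>h\<in>H. h = fst (p h) \<otimes> power_product x (snd (p h)) J \<and> fst (p h) \<in> T"
    by (rule bchoice[THEN exE])
  define \<rho> c where "\<rho> h = fst (p h)" and "c h = snd (p h)" for h
  have coord: "\<rho> h \<otimes> power_product x (c h) J = h" "\<rho> h \<in> T" if "h \<in> H" for h
    using p that by (auto simp: \<rho>_def c_def)
  have coord_mult: "\<rho> (h \<otimes> k) = \<rho> h \<otimes> \<rho> k \<and> (\<forall>i\<in>J. c (h \<otimes> k) i = c h i + c k i)"
    if hk: "h \<in> H" "k \<in> H" for h k
  proof -
    have "h \<otimes> k \<in> H"
      using subgroup.m_closed[OF sub] hk .
    then have "\<rho> (h \<otimes> k) \<otimes> power_product x (c (h \<otimes> k)) J =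
        (\<rho> h \<otimes> power_product x (c h) J) \<otimes> (\<rho> k \<otimes> power_product x (c k) J)"
      using hk by (simp only: coord(1))
    also have "\<dots> = (\<rho> h \<otimes> \<rho> k) \<otimes> power_product x (\<lambda>i. c h i + c k i) J"
      using hk by (intro mult coord(2))
    finally show ?thesis
      using hk \<open>h \<otimes> k \<in> H\<close> by (intro unique) (auto intro: coord(2))
  qed
  show thesis
  proof (rule that)
    show "\<rho> \<in> hom (G\<lparr>carrier := H\<rparr>) (G\<lparr>carrier := T\<rparr>)"
      using coord(2) coord_mult by (auto simp: hom_def)
    show "\<rho> t = t" if "t \<in> T" for t
    proof -
      have "t \<in> H"
        using that T_sub by blast
      then have "\<rho> t \<otimes> power_product x (c t) J = t \<otimes> power_product x (\<lambda>i. 0) J"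
        using coord(1)[of t] that by (simp add: pp_0)
      then show ?thesis
        using unique that coord(2) \<open>t \<in> H\<close> by blast
    qed
    show "\<exists>wt. graded_comm_group (G\<lparr>carrier := H\<rparr>) wt \<and> wt h \<noteq> 0" if "h \<in> H" "h \<notin> T" for h
    proof -
      have "\<exists>i\<in>J. c h i \<noteq> 0"
      proof (rule ccontr)
        assume "\<not> ?thesis"
        then have "power_product x (c h) J = power_product x (\<lambda>i. 0) J"
          by (intro power_product_cong x) auto
        then have "\<rho> h = h"
          using coord[OF that(1)] by (simp add: pp_0)
        then show False
          using coord(2)[OF that(1)] that(2) by simp
      qed
      then obtain i where i: "i \<in> J" "c h i \<noteq> 0"
        by blast
      have "graded_comm_group (G\<lparr>carrier := H\<rparr>) (\<lambda>g. c g i)"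
        using comm_group_subgroup[OF sub] coord_mult i(1)
        by (intro graded_comm_group.intro graded_comm_group_axioms.intro) auto
      with i(2) show ?thesis
        by blast
    qed
  qed (use sub \<open>S \<subseteq> H\<close> T_sub in auto)
qed

end

section \<open>Units in all layers of the augmentation filtration\<close>

lemma normalized_units_omega_iff:
  "u \<in> normalized_units_omega G \<longleftrightarrow>
    u \<in> normalized_units G \<and> (\<forall>n\<ge>1. u - frag_of \<one>\<^bsub>G\<^esub> \<in> augmentation_power G n)"
  by (auto simp: normalized_units_omega_def normalized_units_filt_iff)

lemma frag_push_fixed:
  assumes "\<And>x. x \<in> Poly_Mapping.keys a \<Longrightarrow> h x = x"
  shows "frag_extend (frag_of \<circ> h) a = a"
proof -
  have "frag_extend (frag_of \<circ> h) a = frag_extend frag_of a"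
    by (rule frag_extend_eq) (simp add: assms)
  then show ?thesis
    by (simp only: frag_expansion[symmetric])
qed

context comm_group
begin

lemma normalized_units_iff:
  "u \<in> normalized_units G \<longleftrightarrow> u \<in> ZG \<and> augmentation u = 1 \<and> (\<exists>w\<in>ZG. u \<star> w = frag_of \<one>)"
  by (auto simp: normalized_units_def Units_def int_group_ring_simps(3) ring_mult_comm)

lemma normalized_units_omega_subgroup:
  assumes "subgroup H G"
  shows "normalized_units_omega (G\<lparr>carrier := H\<rparr>) \<subseteq> normalized_units_omega G"
proof
  interpret H: comm_group "G\<lparr>carrier := H\<rparr>"
    using assms by (rule comm_group_subgroup)
  have hom: "(\<lambda>x. x) \<in> hom (G\<lparr>carrier := H\<rparr>) G"
    using subgroup.mem_carrier[OF assms] by (auto simp: hom_def)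
  fix u assume u: "u \<in> normalized_units_omega (G\<lparr>carrier := H\<rparr>)"
  have closed: "a \<in> ZG" if "a \<in> H.ZG" for a
    using that subgroup.subset[OF assms] by (auto simp: ZG_iff H.ZG_iff)
  have "u - frag_of \<one> \<in> augmentation_power G n" if "n \<ge> 1" for n
  proof -
    have "u - frag_of \<one> \<in> augmentation_power (G\<lparr>carrier := H\<rparr>) n"
      using u that by (simp add: normalized_units_omega_iff)
    from frag_push_augmentation_power[OF H.is_group hom this] show ?thesis
      by (subst (asm) frag_push_fixed) auto
  qed
  moreover have "u \<in> normalized_units G"
    using u closed
    by (auto simp: normalized_units_omega_iff H.normalized_units_iff normalized_units_iff
        int_group_ring_subgroup_mult)
  ultimately show "u \<in> normalized_units_omega G"
    by (simp add: normalized_units_omega_iff)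
qed

text \<open>
  In a subgroup that contains all the relevant elements and splits over \<open>T\<close>, every integral weight
  vanishes on the support of \<open>u\<close> by \<open>unit_weight_0\<close>, and the weights detect all elements outside
  \<open>T\<close>. Membership in the second layer of the filtration is what excludes units such as the
  group elements of infinite order.
\<close>

lemma torsion_support:
  assumes u: "u \<in> normalized_units G" and u2: "u - frag_of \<one> \<in> augmentation_power G 2"
  shows "Poly_Mapping.keys u \<subseteq> T"
proof
  fix g assume g: "g \<in> Poly_Mapping.keys u"
  obtain w where uw: "u \<in> ZG" "augmentation u = 1" "w \<in> ZG" "u \<star> w = frag_of \<one>"
    using u by (auto simp: normalized_units_iff)
  obtain S where S: "finite S" "S \<subseteq> carrier G"
    "\<And>H. S \<subseteq> H \<Longrightarrow> u - frag_of \<one> \<in> augmentation_power (G\<lparr>carrier := H\<rparr>) 2"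
    using augmentation_power_finitary[OF u2] by blast
  let ?S = "S \<union> Poly_Mapping.keys u \<union> Poly_Mapping.keys w"
  have "finite ?S" "?S \<subseteq> carrier G"
    using S uw by (auto simp: ZG_iff)
  from torsion_splits_locally[OF this] obtain H where H: "?S \<subseteq> H"
    "\<And>h. h \<in> H \<Longrightarrow> h \<notin> T \<Longrightarrow> \<exists>wt. graded_comm_group (G\<lparr>carrier := H\<rparr>) wt \<and> wt h \<noteq> 0"
    by metis
  show "g \<in> T"
  proof (rule ccontr)
    assume "g \<notin> T"
    then obtain wt where wt: "graded_comm_group (G\<lparr>carrier := H\<rparr>) wt" "wt g \<noteq> 0"
      using H g by blast
    interpret H: graded_comm_group "G\<lparr>carrier := H\<rparr>" wt
      by fact
    have "wt g = 0"
      by (rule H.unit_weight_0[of u w])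
        (use H(1) S(3) uw g in \<open>auto simp: H.ZG_iff int_group_ring_subgroup_mult\<close>)
    with wt(2) show False ..
  qed
qed

text \<open>
  The retraction \<open>\<rho>\<close> of a suitable subgroup onto \<open>T\<close> fixes \<open>a\<close> and maps
  powers of the augmentation ideal into powers of the augmentation ideal.
\<close>

lemma augmentation_power_torsion:
  assumes a: "a \<in> augmentation_power G n" and keys: "Poly_Mapping.keys a \<subseteq> T"
  shows "a \<in> augmentation_power (G\<lparr>carrier := T\<rparr>) n"
proof -
  obtain S where S: "finite S" "S \<subseteq> carrier G"
    "\<And>H. S \<subseteq> H \<Longrightarrow> a \<in> augmentation_power (G\<lparr>carrier := H\<rparr>) n"
    using augmentation_power_finitary[OF a] by blast
  from torsion_splits_locally[OF S(1,2)] obtain H \<rho> where H: "subgroup H G" "S \<subseteq> H"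
    "\<rho> \<in> hom (G\<lparr>carrier := H\<rparr>) (G\<lparr>carrier := T\<rparr>)" "\<And>t. t \<in> T \<Longrightarrow> \<rho> t = t"
    by metis
  have "frag_extend (frag_of \<circ> \<rho>) a \<in> augmentation_power (G\<lparr>carrier := T\<rparr>) n"
    using subgroup_imp_group[OF H(1)] H(3) S(3)[OF H(2)] by (rule frag_push_augmentation_power)
  then show ?thesis
    using H(4) keys by (subst (asm) frag_push_fixed) auto
qed

text \<open>
  The inverse \<open>w\<close> of \<open>u\<close> is a priori only known in the larger ring; its image under a retraction
  onto \<open>T\<close> is an inverse with torsion support.
\<close>

lemma normalized_units_torsion:
  assumes u: "u \<in> normalized_units G" and keys: "Poly_Mapping.keys u \<subseteq> T"
  shows "u \<in> normalized_units (G\<lparr>carrier := T\<rparr>)"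
proof -
  interpret T: comm_group "G\<lparr>carrier := T\<rparr>"
    using torsion_subgroup by (rule comm_group_subgroup)
  obtain w where uw: "u \<in> ZG" "augmentation u = 1" "w \<in> ZG" "u \<star> w = frag_of \<one>"
    using u by (auto simp: normalized_units_iff)
  have "finite (Poly_Mapping.keys w)" "Poly_Mapping.keys w \<subseteq> carrier G"
    using uw by (auto simp: ZG_iff)
  from torsion_splits_locally[OF this] obtain H \<rho> where H: "Poly_Mapping.keys w \<subseteq> H" "T \<subseteq> H"
    "\<rho> \<in> hom (G\<lparr>carrier := H\<rparr>) (G\<lparr>carrier := T\<rparr>)" "\<And>t. t \<in> T \<Longrightarrow> \<rho> t = t"
    by metis
  let ?\<rho> = "frag_extend (frag_of \<circ> \<rho>)"
  have "?\<rho> (u \<star> w) = ?\<rho> u \<star> ?\<rho> w"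
    using frag_push_mult[OF H(3), of u w] H(1,2) keys by (simp add: int_group_ring_subgroup_mult)
  moreover have "?\<rho> u = u"
    using keys H(4) by (intro frag_push_fixed) auto
  moreover have "?\<rho> (frag_of \<one>) = frag_of \<one>"
    using H(4) subgroup.one_closed[OF torsion_subgroup] by simp
  ultimately have "u \<star> ?\<rho> w = frag_of \<one>"
    using uw(4) by metis
  moreover have "?\<rho> w \<in> T.ZG"
    using frag_push_closed[OF H(3), of w] H(1) by (simp only: T.ZG_iff) simp
  ultimately show ?thesis
    using uw(2) keys by (auto simp: T.normalized_units_iff T.ZG_iff int_group_ring_subgroup_mult)
qed

lemma normalized_units_omega_torsion:
  "normalized_units_omega G = normalized_units_omega (G\<lparr>carrier := T\<rparr>)"
proof
  show "normalized_units_omega (G\<lparr>carrier := T\<rparr>) \<subseteq> normalized_units_omega G"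
    by (rule normalized_units_omega_subgroup) (rule torsion_subgroup)
  show "normalized_units_omega G \<subseteq> normalized_units_omega (G\<lparr>carrier := T\<rparr>)"
  proof
    fix u assume "u \<in> normalized_units_omega G"
    then have u: "u \<in> normalized_units G" "\<And>n. n \<ge> 1 \<Longrightarrow> u - frag_of \<one> \<in> augmentation_power G n"
      by (simp_all add: normalized_units_omega_iff)
    have keys: "Poly_Mapping.keys u \<subseteq> T"
      using u(1) u(2)[of 2] by (intro torsion_support) auto
    then have "Poly_Mapping.keys (u - frag_of \<one>) \<subseteq> T"
      using keys_diff[of u "frag_of \<one>"] subgroup.one_closed[OF torsion_subgroup] by auto
    then show "u \<in> normalized_units_omega (G\<lparr>carrier := T\<rparr>)"
      using u(2) normalized_units_torsion[OF u(1) keys]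
      by (simp add: normalized_units_omega_iff augmentation_power_torsion)
  qed
qed

end

theorem theorem10:
  fixes G :: "('a, 'b) monoid_scheme"
  assumes "comm_group G"
  shows "normalized_units_omega G = {\<one>\<^bsub>int_group_ring G\<^esub>} \<longleftrightarrow>
         normalized_units_omega (G\<lparr>carrier := torsion_subgroup G\<rparr>) =
           {\<one>\<^bsub>int_group_ring (G\<lparr>carrier := torsion_subgroup G\<rparr>)\<^esub>}"
  using comm_group.normalized_units_omega_torsion[OF assms] by (simp add: int_group_ring_simps(3))

end
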